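(* Let $X$ be a Banach space such that $\epsilon_0(X)<1$, and let $K\subset X$ be a nonempty, closed, bounded, and convex subset. If $T\colon K\to K$ is of asymptotically Hölder nonexpansive type, then there exists $x\in K$ such that $T^n x\to x$ in norm as $n\to\infty$.
   Context: The modulus of convexity of a Banach space $X$ is $\delta_X\colon[0,2]\to[0,1]$, $\delta_X(\epsilon)=\inf\{1-\|\frac{x+y}{2}\| : \|x\|\le 1,\ \|y\|\le 1,\ \|x-y\|\ge\epsilon\}$. The characteristic of convexity of $X$ is $\epsilon_0(X)=\sup\{\epsilon\in[0,2]:\delta_X(\epsilon)=0\}$. Let $K$ be a nonempty subset of $X$. A mapping $T\colon K\to K$ (not assumed continuous) is of asymptotically Hölder nonexpansive type if there exists a sequence $(\alpha_n)\subset(0,1]$ with $\alpha_n\to1$ such that, for every $x\in K$, $\limsup_{n\to\infty}\sup_{y\in K}\left(\|T^n x-T^n y\|-\|x-y\|^{\alpha_n}\right)\le 0$. Here $T^n$ denotes the $n$-th iterate of $T$. *)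

theory Defs
  imports "HOL-Analysis.Analysis"
begin

text \<open>The infimum and the supremum below are taken in \<open>[0,1]\<close> and \<open>[0,2]\<close>, the codomain of the
  modulus of convexity and the range of \<open>\<epsilon>\<close>: inserting \<open>1\<close>, resp. \<open>0\<close>, fixes the value of
  the empty infimum, resp. supremum, which only arises for the zero space (for \<open>\<epsilon> \<le> 2\<close>).
  The Banach space is the whole type \<open>'a\<close>, passed as a type argument.\<close>

definition modulus_of_convexity :: "'a::banach itself \<Rightarrow> real \<Rightarrow> real" where
  "modulus_of_convexity _ \<epsilon> =
     Inf (insert 1 {1 - norm ((1 / 2) *\<^sub>R (x + y)) | x y :: 'a.
                      norm x \<le> 1 \<and> norm y \<le> 1 \<and> norm (x - y) \<ge> \<epsilon>})"

definition characteristic_of_convexity :: "'a::banach itself \<Rightarrow> real" where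
  "characteristic_of_convexity X =
     Sup (insert 0 {\<epsilon> \<in> {0..2}. modulus_of_convexity X \<epsilon> = 0})"

text \<open>The supremum over \<open>K\<close> may be infinite when \<open>K\<close> is unbounded, hence the extended reals.
  Note that \<open>0 powr a = 0\<close>.\<close>

definition asymptotically_Hoelder_nonexpansive_type ::
  "'a::banach set \<Rightarrow> ('a \<Rightarrow> 'a) \<Rightarrow> bool" where
  "asymptotically_Hoelder_nonexpansive_type K T \<longleftrightarrow>
     (\<exists>\<alpha> :: nat \<Rightarrow> real. (\<forall>n. \<alpha> n \<in> {0<..1}) \<and> \<alpha> \<longlonglongrightarrow> 1 \<and>
        (\<forall>x\<in>K. limsup (\<lambda>n. SUP y\<in>K.
           ereal (norm ((T ^^ n) x - (T ^^ n) y) - norm (x - y) powr \<alpha> n)) \<le> 0))"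

end

theory Submission
  imports Defs
begin

text \<open>The defect of a point \<open>x\<close> is the upper limit of the distances from \<open>T\<^sup>n x\<close> to \<open>x\<close>; a point of
  defect \<open>0\<close> is wanted. The mapping enters only through the following consequence of the
  hypothesis: for \<open>x \<in> K\<close> and \<open>0 < s < t\<close>, all late iterates of \<open>T\<close> carry the points of \<open>K\<close> within
  \<open>s\<close> of \<open>x\<close> to points within \<open>t\<close> of the iterate of \<open>x\<close> (lemma \<open>eventually_almost_nonexpansive\<close>).

  Let \<open>y\<close> have defect at most \<open>d\<close>, and let \<open>r \<le> d\<close> be the asymptotic radius in \<open>K\<close> of the orbit of
  \<open>y\<close>. If \<open>z\<close> nearly attains \<open>r\<close>, so does \<open>T\<^sup>m z\<close> for every large \<open>m\<close>. When the characteristic of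
  convexity is below \<open>p < 1\<close>, the midpoint of \<open>z\<close> and \<open>T\<^sup>m z\<close> would beat \<open>r\<close> if these two points
  were further apart than about \<open>p r\<close>. Hence \<open>z\<close> has defect at most \<open>q d\<close> with a fixed \<open>q < 1\<close>, and
  \<open>z\<close> is within \<open>3 d\<close> of \<open>y\<close> (lemma \<open>smaller_defect_nearby\<close>). Approximate asymptotic centres are
  enough here, so that no weak compactness is used.

  Iterating produces a Cauchy sequence of points whose defects tend to \<open>0\<close>, and the limit has
  defect \<open>0\<close> because late iterates hardly enlarge its distances to the points of the sequence.\<close>

text \<open>The witness \<open>\<delta>\<close> is the modulus of convexity at \<open>p\<close>, which is positive because \<open>p\<close> exceeds
  the characteristic; the bound is its definition rescaled to the ball of radius \<open>t\<close>.\<close>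

lemma characteristic_less_imp_midpoint_bound:
  fixes p :: real
  assumes "characteristic_of_convexity TYPE('a::banach) < p" "0 < p" "p \<le> 2"
  obtains \<delta> where "0 < \<delta>" "\<delta> \<le> 1"
    "\<And>(u::'a) v t. \<lbrakk>norm u \<le> t; norm v \<le> t; p * t \<le> norm (u - v); 0 < t\<rbrakk>
       \<Longrightarrow> norm ((1 / 2) *\<^sub>R (u + v)) \<le> (1 - \<delta>) * t"
proof -
  define S where "S = insert 1 {1 - norm ((1 / 2) *\<^sub>R (x + y)) | x y :: 'a.
                      norm x \<le> 1 \<and> norm y \<le> 1 \<and> norm (x - y) \<ge> p}"
  define \<delta> where "\<delta> = modulus_of_convexity TYPE('a) p"
  have \<delta>_S: "\<delta> = Inf S"
    unfolding \<delta>_def S_def modulus_of_convexity_def ..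
  have nonneg: "0 \<le> s" if "s \<in> S" for s
  proof (cases "s = 1")
    case False
    then obtain x y :: 'a where s: "s = 1 - norm ((1 / 2) *\<^sub>R (x + y))"
      and "norm x \<le> 1" "norm y \<le> 1"
      using \<open>s \<in> S\<close> unfolding S_def by blast
    then have "norm (x + y) \<le> 2"
      using norm_triangle_ineq[of x y] by linarith
    then show ?thesis using s by simp
  qed simp
  then have bdd: "bdd_below S" by (meson bdd_belowI)
  have le: "\<delta> \<le> s" if "s \<in> S" for s
    unfolding \<delta>_S using that bdd by (rule cInf_lower)
  have "0 \<le> \<delta>"
    unfolding \<delta>_S using nonneg by (intro cInf_greatest) (simp_all add: S_def)
  moreover have "\<delta> \<noteq> 0"
  proof
    assume "\<delta> = 0"
    then have "p \<le> characteristic_of_convexity TYPE('a)"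
      unfolding characteristic_of_convexity_def \<delta>_def
      using assms(2,3) by (intro cSup_upper) (auto intro!: bdd_aboveI[of _ 2])
    then show False using assms(1) by simp
  qed
  moreover have "\<delta> \<le> 1" by (rule le) (simp add: S_def)
  moreover have "norm ((1 / 2) *\<^sub>R (u + v)) \<le> (1 - \<delta>) * t"
    if uv: "norm u \<le> t" "norm v \<le> t" "p * t \<le> norm (u - v)" "0 < t" for u v :: 'a and t
  proof -
    let ?u = "(1 / t) *\<^sub>R u" and ?v = "(1 / t) *\<^sub>R v"
    have "norm ?u \<le> 1" "norm ?v \<le> 1" using uv by simp_all
    moreover have "norm (?u - ?v) = norm (u - v) / t"
      unfolding scaleR_diff_right[symmetric] using uv(4) by simp
    then have "p \<le> norm (?u - ?v)" using uv by (simp add: pos_le_divide_eq)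
    ultimately have "\<delta> \<le> 1 - norm ((1 / 2) *\<^sub>R (?u + ?v))"
      by (intro le) (auto simp: S_def)
    moreover have "norm ((1 / 2) *\<^sub>R (?u + ?v)) = norm ((1 / 2) *\<^sub>R (u + v)) / t"
      unfolding scaleR_add_right[symmetric] using uv(4) by simp
    ultimately have "norm ((1 / 2) *\<^sub>R (u + v)) / t \<le> 1 - \<delta>" by linarith
    then show ?thesis using uv(4) by (simp only: pos_divide_le_eq)
  qed
  ultimately show ?thesis by (intro that[of \<delta>]) simp_all
qed

lemma eventually_almost_nonexpansive:
  fixes K :: "'a::banach set"
  assumes "asymptotically_Hoelder_nonexpansive_type K T" "x \<in> K" "0 < s" "s < t"
  shows "\<forall>\<^sub>F n in sequentially. \<forall>y\<in>K. norm (x - y) \<le> s \<longrightarrow> norm ((T ^^ n) x - (T ^^ n) y) \<le> t"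
proof -
  obtain \<alpha> :: "nat \<Rightarrow> real" where \<alpha>: "\<And>n. 0 < \<alpha> n" "\<alpha> \<longlonglongrightarrow> 1"
    and lim: "limsup (\<lambda>n. SUP y\<in>K.
           ereal (norm ((T ^^ n) x - (T ^^ n) y) - norm (x - y) powr \<alpha> n)) \<le> 0"
    using assms(1,2) unfolding asymptotically_Hoelder_nonexpansive_type_def
    by (auto simp: greaterThanAtMost_iff)
  define \<eta> where "\<eta> = (t - s) / 2"
  have "0 < \<eta>" using assms(4) by (simp add: \<eta>_def)
  have "limsup (\<lambda>n. SUP y\<in>K.
           ereal (norm ((T ^^ n) x - (T ^^ n) y) - norm (x - y) powr \<alpha> n)) < ereal \<eta>"
    using lim \<open>0 < \<eta>\<close> by (simp add: order.strict_trans1)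
  then have ev1: "\<forall>\<^sub>F n in sequentially. (SUP y\<in>K.
           ereal (norm ((T ^^ n) x - (T ^^ n) y) - norm (x - y) powr \<alpha> n)) < ereal \<eta>"
    by (rule Limsup_lessD)
  have "(\<lambda>n. s powr \<alpha> n) \<longlonglongrightarrow> s powr 1"
    using \<alpha>(2) assms(3) by (intro tendsto_intros) auto
  then have ev2: "\<forall>\<^sub>F n in sequentially. s powr \<alpha> n < s + \<eta>"
    using assms(3) \<open>0 < \<eta>\<close> by (intro order_tendstoD(2)) auto
  show ?thesis
    using ev1 ev2
  proof eventually_elim
    case (elim n)
    show ?case
    proof (intro ballI impI)
      fix y assume y: "y \<in> K" "norm (x - y) \<le> s"
      have "ereal (norm ((T ^^ n) x - (T ^^ n) y) - norm (x - y) powr \<alpha> n) < ereal \<eta>"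
        using elim(1) y(1) by (meson SUP_upper order.strict_trans1)
      then have "norm ((T ^^ n) x - (T ^^ n) y) < norm (x - y) powr \<alpha> n + \<eta>" by simp
      moreover have "norm (x - y) powr \<alpha> n \<le> s powr \<alpha> n"
        using y(2) \<alpha>(1)[of n] by (intro powr_mono2) auto
      ultimately have "norm ((T ^^ n) x - (T ^^ n) y) \<le> s + \<eta> + \<eta>"
        using elim(2) by linarith
      then show "norm ((T ^^ n) x - (T ^^ n) y) \<le> t" by (simp add: \<eta>_def)
    qed
  qed
qed

lemma funpow_in_self_map: "T \<in> K \<rightarrow> K \<Longrightarrow> x \<in> K \<Longrightarrow> (T ^^ n) x \<in> K"
  by (induction n) auto

text \<open>The contraction of defects. In the proof, \<open>r\<close> is the asymptotic radius of the orbit of \<open>y\<close>: the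
  infimum of the \<open>\<rho>\<close> such that some point of \<open>K\<close> has all late iterates of \<open>y\<close> within \<open>\<rho>\<close>. It is at
  most \<open>d\<close>, since \<open>y\<close> itself is such a point for \<open>\<rho> = d\<close>.\<close>

lemma smaller_defect_nearby:
  fixes K :: "'a::real_normed_vector set"
  assumes "convex K" and T: "T \<in> K \<rightarrow> K"
    and almost: "\<And>x s t. \<lbrakk>x \<in> K; 0 < s; s < t\<rbrakk> \<Longrightarrow>
      \<forall>\<^sub>F n in sequentially. \<forall>y\<in>K. norm (x - y) \<le> s \<longrightarrow> norm ((T ^^ n) x - (T ^^ n) y) \<le> t"
    and \<delta>: "0 < \<delta>" "\<delta> \<le> 1"
    and mid: "\<And>(u::'a) v t. \<lbrakk>norm u \<le> t; norm v \<le> t; p * t \<le> norm (u - v); 0 < t\<rbrakk>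
       \<Longrightarrow> norm ((1 / 2) *\<^sub>R (u + v)) \<le> (1 - \<delta>) * t"
    and p: "0 < p" "p < 1" and q: "q = (1 + p) / 2"
    and y: "y \<in> K" and d: "0 < d" "\<forall>\<^sub>F n in sequentially. norm ((T ^^ n) y - y) \<le> d"
  obtains z where "z \<in> K" "norm (z - y) \<le> 3 * d"
    "\<forall>\<^sub>F n in sequentially. norm ((T ^^ n) z - z) \<le> q * d"
proof -
  define R where "R = {\<rho>. \<exists>z\<in>K. \<forall>\<^sub>F n in sequentially. norm ((T ^^ n) y - z) \<le> \<rho>}"
  define r where "r = Inf R"
  have R_nonneg: "0 \<le> \<rho>" if \<rho>: "\<rho> \<in> R" for \<rho>
  proof -
    obtain z where "\<forall>\<^sub>F n in sequentially. norm ((T ^^ n) y - z) \<le> \<rho>"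
      using \<rho> unfolding R_def by blast
    then obtain n where "norm ((T ^^ n) y - z) \<le> \<rho>"
      using eventually_happens by fastforce
    then show ?thesis using norm_ge_zero[of "(T ^^ n) y - z"] by linarith
  qed
  then have bdd: "bdd_below R" by (meson bdd_belowI)
  have dR: "d \<in> R" using d y unfolding R_def by blast
  have r: "0 \<le> r" "r \<le> d"
    unfolding r_def using R_nonneg dR bdd by (auto intro: cInf_greatest cInf_lower)
  \<comment> \<open>\<open>t\<close> is slightly above the asymptotic radius. When that radius vanishes, midpoints are of no
    help, but the triangle inequality already gives the bound.\<close>
  obtain t where t: "r < t" "t \<le> 2 * d" and
    small: "(1 - \<delta>) * t < r \<and> p * t \<le> q * d \<or> 2 * t \<le> q * d"
  proof (cases "r = 0")
    case True
    have "0 < q" "q < 1" using p q by auto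
    then have "0 < q * d" "q * d \<le> d" using d(1) by auto
    then show ?thesis
      using True d(1) by (intro that[of "q * d / 2"]) auto
  next
    case False
    \<comment> \<open>\<open>\<kappa> \<le> \<delta>\<close> gives \<open>(1 - \<delta>) * (1 + \<kappa>) < 1\<close>, and \<open>\<kappa> \<le> (1 - p) / 2\<close> gives \<open>p * (1 + \<kappa>) \<le> q\<close>.\<close>
    define \<kappa> where "\<kappa> = min \<delta> ((1 - p) / 2)"
    have \<kappa>: "0 < \<kappa>" "\<kappa> \<le> \<delta>" "\<kappa> \<le> (1 - p) / 2" "\<kappa> \<le> 1"
      unfolding \<kappa>_def min_less_iff_conj min_le_iff_disj using \<delta> p by auto
    have "0 < r" using r False by simp
    have "(1 - \<delta>) * (1 + \<kappa>) \<le> (1 - \<delta>) * (1 + \<delta>)"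
      using \<kappa> \<delta> by (intro mult_left_mono) auto
    also have "\<dots> < 1" using \<delta>(1) by (simp add: algebra_simps)
    finally have 1: "(1 - \<delta>) * ((1 + \<kappa>) * r) < r"
      using \<open>0 < r\<close> by (simp flip: mult.assoc)
    have "p * \<kappa> \<le> \<kappa>" using p \<kappa>(1) by (simp add: mult_left_le_one_le)
    then have "p * (1 + \<kappa>) \<le> q" using \<kappa>(3) unfolding q by (simp add: field_simps)
    then have "p * (1 + \<kappa>) * r \<le> q * d"
      using r p q by (intro mult_mono) auto
    then have 2: "p * ((1 + \<kappa>) * r) \<le> q * d" by (simp add: mult.assoc)
    have "(1 + \<kappa>) * r \<le> 2 * d" using \<kappa> r by (intro mult_mono) auto
    then show ?thesis
      using 1 2 \<kappa>(1) \<open>0 < r\<close> by (intro that[of "(1 + \<kappa>) * r"]) auto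
  qed
  have "0 < t" using r t by simp
  obtain \<rho> where \<rho>: "\<rho> \<in> R" "\<rho> < t"
    using t(1) cInf_lessD[of R t] dR unfolding r_def by blast
  define s where "s = max \<rho> (t / 2)"
  have s: "0 < s" "s < t" "\<rho> \<le> s" using \<rho>(2) \<open>0 < t\<close> by (auto simp: s_def)
  obtain z where z: "z \<in> K" "\<forall>\<^sub>F n in sequentially. norm ((T ^^ n) y - z) \<le> \<rho>"
    using \<rho>(1) unfolding R_def by blast
  have zs: "\<forall>\<^sub>F n in sequentially. norm ((T ^^ n) y - z) \<le> s"
    using z(2) s(3) by (auto elim: eventually_mono)
  have defect: "\<forall>\<^sub>F m in sequentially. norm ((T ^^ m) z - z) \<le> q * d"
    using almost[OF z(1) s(1,2)]
  proof eventually_elim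
    case (elim m)
    \<comment> \<open>\<open>T\<^sup>m\<close> carries the late iterates of \<open>y\<close>, which are near \<open>z\<close>, to later iterates near \<open>T\<^sup>m z\<close>.\<close>
    have "\<forall>\<^sub>F n in sequentially. norm ((T ^^ (n + m)) y - (T ^^ m) z) \<le> t"
      using zs
    proof eventually_elim
      case (elim n)
      have "(T ^^ (n + m)) y = (T ^^ m) ((T ^^ n) y)"
        by (simp add: add.commute[of n m] funpow_add)
      then show ?case
        using \<open>\<forall>y\<in>K. _ \<longrightarrow> _\<close> elim funpow_in_self_map[OF T y, of n]
        by (simp add: norm_minus_commute[of _ z] norm_minus_commute[of _ "(T ^^ m) z"])
    qed
    then have near: "\<forall>\<^sub>F n in sequentially. norm ((T ^^ n) y - (T ^^ m) z) \<le> t"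
      by (subst (asm) eventually_sequentially_seg)
    have both: "\<forall>\<^sub>F n in sequentially.
        norm ((T ^^ n) y - z) \<le> t \<and> norm ((T ^^ n) y - (T ^^ m) z) \<le> t"
      using zs near by eventually_elim (use s(2) in auto)
    show ?case
    proof (rule disjE[OF small])
      assume "2 * t \<le> q * d"
      obtain n where "norm ((T ^^ n) y - z) \<le> t" "norm ((T ^^ n) y - (T ^^ m) z) \<le> t"
        using eventually_happens[OF both] by auto
      then have "norm ((T ^^ m) z - z) \<le> t + t"
        by (intro norm_diff_triangle_le[of _ "(T ^^ n) y"]) (simp_all add: norm_minus_commute)
      then show ?thesis using \<open>2 * t \<le> q * d\<close> by linarith
    next
      assume *: "(1 - \<delta>) * t < r \<and> p * t \<le> q * d"
      show ?thesis
      proof (rule ccontr)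
        assume "\<not> ?thesis"
        then have far: "p * t \<le> norm ((T ^^ m) z - z)" using * by linarith
        define c where "c = (1 / 2) *\<^sub>R z + (1 / 2) *\<^sub>R (T ^^ m) z"
        have "c \<in> K"
          unfolding c_def using assms(1) z(1) funpow_in_self_map[OF T z(1), of m]
          by (auto simp: convex_def)
        moreover have "\<forall>\<^sub>F n in sequentially. norm ((T ^^ n) y - c) \<le> (1 - \<delta>) * t"
          using both
        proof eventually_elim
          case (elim n)
          have "(T ^^ n) y = (1 / 2) *\<^sub>R (T ^^ n) y + (1 / 2) *\<^sub>R (T ^^ n) y"
            by (simp flip: scaleR_left_distrib)
          then have "(T ^^ n) y - c
              = (1 / 2) *\<^sub>R (((T ^^ n) y - z) + ((T ^^ n) y - (T ^^ m) z))"
            unfolding c_def by (simp add: algebra_simps)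
          moreover have "((T ^^ n) y - z) - ((T ^^ n) y - (T ^^ m) z) = (T ^^ m) z - z"
            by simp
          ultimately show ?case
            using mid[of "(T ^^ n) y - z" t "(T ^^ n) y - (T ^^ m) z"] elim far \<open>0 < t\<close> by simp
        qed
        ultimately have "(1 - \<delta>) * t \<in> R" unfolding R_def by blast
        then have "r \<le> (1 - \<delta>) * t" unfolding r_def using bdd by (rule cInf_lower)
        then show False using * by simp
      qed
    qed
  qed
  have "\<forall>\<^sub>F n in sequentially. norm ((T ^^ n) y - z) \<le> s \<and> norm ((T ^^ n) y - y) \<le> d"
    using zs d(2) by (rule eventually_conj)
  then obtain n where "norm ((T ^^ n) y - z) \<le> s" "norm ((T ^^ n) y - y) \<le> d"
    using eventually_happens by fastforce
  then have "norm (z - y) \<le> s + d"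
    by (intro norm_diff_triangle_le[of _ "(T ^^ n) y"]) (simp_all add: norm_minus_commute)
  then have "norm (z - y) \<le> 3 * d" using s(2) t(2) by linarith
  then show ?thesis using that z(1) defect by blast
qed

lemma convergent_if_geometric_steps:
  fixes f :: "nat \<Rightarrow> 'a::banach"
  assumes "\<And>n. norm (f (Suc n) - f n) \<le> c * q ^ n" "0 \<le> q" "q < 1"
  shows "convergent f"
proof -
  have "summable (\<lambda>n. c * q ^ n)"
    using assms(2,3) by (intro summable_mult summable_geometric) simp
  then have "summable (\<lambda>n. f (Suc n) - f n)"
    using assms(1) by (rule summable_comparison_test'[where N = 0])
  then have "convergent (\<lambda>n. f n - f 0)"
    by (simp add: summable_iff_convergent sum_lessThan_telescope)
  then show ?thesis
    using convergent_diff_const_right_iff by blast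
qed

theorem theorem3p1:
  fixes K :: "'a::banach set" and T :: "'a \<Rightarrow> 'a"
  assumes "characteristic_of_convexity TYPE('a) < 1"
    and "K \<noteq> {}" and "closed K" and "bounded K" and "convex K"
    and "T \<in> K \<rightarrow> K"
    and "asymptotically_Hoelder_nonexpansive_type K T"
  shows "\<exists>x\<in>K. (\<lambda>n. (T ^^ n) x) \<longlonglongrightarrow> x"
proof -
  obtain p where p: "max 0 (characteristic_of_convexity TYPE('a)) < p" "p < 1"
    using dense[of "max 0 (characteristic_of_convexity TYPE('a))" 1] assms(1) by auto
  have "characteristic_of_convexity TYPE('a) < p" "0 < p" "p \<le> 2" using p by auto
  then obtain \<delta> where \<delta>: "0 < \<delta>" "\<delta> \<le> 1"
    "\<And>(u::'a) v t. \<lbrakk>norm u \<le> t; norm v \<le> t; p * t \<le> norm (u - v); 0 < t\<rbrakk>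
       \<Longrightarrow> norm ((1 / 2) *\<^sub>R (u + v)) \<le> (1 - \<delta>) * t"
    using characteristic_less_imp_midpoint_bound by blast
  note almost = eventually_almost_nonexpansive[OF assms(7)]
  define q where "q = (1 + p) / 2"
  have q: "0 < q" "q < 1" using p by (auto simp: q_def)
  obtain x0 where x0: "x0 \<in> K" using assms(2) by blast
  obtain d where d: "0 < d" "\<And>x. x \<in> K \<Longrightarrow> norm (x - x0) \<le> d"
  proof -
    obtain B where "\<And>x. x \<in> K \<Longrightarrow> dist x0 x \<le> B"
      using assms(4) bounded_any_center[of K x0] by blast
    then show ?thesis
      by (intro that[of "max 1 B"]) (auto simp: dist_norm norm_minus_commute le_max_iff_disj)
  qed
  let ?P = "\<lambda>n x. x \<in> K \<and> (\<forall>\<^sub>F m in sequentially. norm ((T ^^ m) x - x) \<le> d * q ^ n)"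
  have "\<exists>f. \<forall>n. ?P n (f n) \<and> norm (f (Suc n) - f n) \<le> 3 * (d * q ^ n)"
  proof (rule dependent_nat_choice)
    show "\<exists>x. ?P 0 x"
      using x0 d(2) funpow_in_self_map[OF assms(6) x0] by (intro exI[of _ x0]) simp
  next
    fix x n assume x: "?P n x"
    have pos: "0 < d * q ^ n" using d(1) q(1) by simp
    obtain z where "z \<in> K" "norm (z - x) \<le> 3 * (d * q ^ n)"
      "\<forall>\<^sub>F m in sequentially. norm ((T ^^ m) z - z) \<le> q * (d * q ^ n)"
      by (rule smaller_defect_nearby[OF assms(5,6) almost \<delta> \<open>0 < p\<close> p(2) q_def conjunct1[OF x]
            pos conjunct2[OF x]])
    then show "\<exists>z. ?P (Suc n) z \<and> norm (z - x) \<le> 3 * (d * q ^ n)"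
      by (intro exI[of _ z]) (simp add: ac_simps)
  qed
  then obtain f where fK: "\<And>n. f n \<in> K"
    and f_defect: "\<And>n. \<forall>\<^sub>F m in sequentially. norm ((T ^^ m) (f n) - f n) \<le> d * q ^ n"
    and f_step: "\<And>n. norm (f (Suc n) - f n) \<le> (3 * d) * q ^ n"
    by (auto simp: mult.assoc)
  have "convergent f"
    using f_step q by (intro convergent_if_geometric_steps[of f "3 * d" q]) auto
  then obtain z where z: "f \<longlonglongrightarrow> z" by (auto simp: convergent_def)
  have zK: "z \<in> K" using assms(3) fK z closed_sequentially by blast
  have "(\<lambda>n. (T ^^ n) z) \<longlonglongrightarrow> z"
  proof (rule tendstoI)
    fix e :: real assume "0 < e"
    have "(\<lambda>n. d * q ^ n) \<longlonglongrightarrow> 0"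
      using q by (intro tendsto_mult_right_zero LIMSEQ_realpow_zero) auto
    then have "\<forall>\<^sub>F n in sequentially. d * q ^ n < e / 4"
      using \<open>0 < e\<close> by (intro order_tendstoD(2)) auto
    moreover have "\<forall>\<^sub>F n in sequentially. dist (f n) z < e / 4"
      using z \<open>0 < e\<close> by (intro tendstoD) auto
    ultimately have "\<forall>\<^sub>F n in sequentially. d * q ^ n < e / 4 \<and> dist (f n) z < e / 4"
      by (rule eventually_conj)
    then obtain k where k: "d * q ^ k < e / 4" "dist (f k) z < e / 4"
      using eventually_happens by fastforce
    have "\<forall>\<^sub>F n in sequentially.
        \<forall>y\<in>K. norm (z - y) \<le> e / 4 \<longrightarrow> norm ((T ^^ n) z - (T ^^ n) y) \<le> e / 2"
      using \<open>0 < e\<close> by (intro almost[OF zK]) auto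
    then show "\<forall>\<^sub>F n in sequentially. dist ((T ^^ n) z) z < e"
      using f_defect[of k]
    proof eventually_elim
      case (elim n)
      have "dist ((T ^^ n) z) ((T ^^ n) (f k)) \<le> e / 2"
        using elim(1) fK[of k] k(2) by (simp add: dist_norm norm_minus_commute[of "f k" z])
      moreover have "dist ((T ^^ n) (f k)) (f k) < e / 4"
        using elim(2) k(1) by (simp add: dist_norm)
      ultimately show ?case
        using k(2) dist_triangle[of "(T ^^ n) z" z "(T ^^ n) (f k)"]
          dist_triangle[of "(T ^^ n) (f k)" z "f k"] by linarith
    qed
  qed
  then show ?thesis using zK by blast
qed

end
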